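(* Let $\Omega\subseteq\mathbb{H}^n\cong\mathbb{R}^{4n}$ be a domain. Then: (1) $d_0d_1=-d_1d_0$ on $C_0^\infty(\Omega,\wedge^{p}\mathbb{C}^{2n})$ for every $p$. (2) $d_0^2=d_1^2=0$. (3) For $F\in C_0^\infty(\Omega,\wedge^{p}\mathbb{C}^{2n})$, $G\in C_0^\infty(\Omega,\wedge^{q}\mathbb{C}^{2n})$ one has $$d_\alpha(F\wedge G)=d_\alpha F\wedge G+(-1)^{p}F\wedge d_\alpha G,\qquad \alpha=0,1.$$
   Context: Points of $\mathbb{H}^n\cong\mathbb{R}^{4n}$ are $q=(q_0,\dots,q_{n-1})$, $q_l=x_{4l}+\mathbf{i}x_{4l+1}+\mathbf{j}x_{4l+2}+\mathbf{k}x_{4l+3}$. Define complex first-order constant-coefficient differential operators $\nabla_{j\alpha}$, $j=0,\dots,2n-1$, $\alpha=0,1$, by (here $\mathbf{i}$ is the imaginary unit of $\mathbb{C}$), for $l=0,\dots,n-1$: $\nabla_{(2l)0}=\partial_{x_{4l}}+\mathbf{i}\partial_{x_{4l+1}}$, $\nabla_{(2l)1}=-\partial_{x_{4l+2}}-\mathbf{i}\partial_{x_{4l+3}}$, $\nabla_{(2l+1)0}=\partial_{x_{4l+2}}-\mathbf{i}\partial_{x_{4l+3}}$, $\nabla_{(2l+1)1}=\partial_{x_{4l}}-\mathbf{i}\partial_{x_{4l+1}}$. Fix a basis $\{\omega^0,\dots,\omega^{2n-1}\}$ of $\mathbb{C}^{2n}$, and for a multi-index $I=(i_1,\dots,i_p)$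 put $\omega^I=\omega^{i_1}\wedge\dots\wedge\omega^{i_p}$. For $F=\sum_I f_I\omega^I$ with values in $\wedge^p\mathbb{C}^{2n}$, define $d_\alpha F=\sum_{k,I}\nabla_{k\alpha}f_I\,\omega^k\wedge\omega^I$, $\alpha=0,1$, where $k$ runs over $0,\dots,2n-1$. *)

theory Defs
  imports "HOL-Analysis.Analysis"
begin

text \<open>
  Throughout, n is \<open>CARD('n)\<close> for an arbitrary finite type \<open>'n\<close>. The type \<open>'n bit0\<close> from
  \<open>HOL-Library.Numeral_Type\<close> consists of the integers 0, ..., 2n - 1 with their usual order, so
  \<open>'n bit0 bit0\<close> consists of 0, ..., 4n - 1, and \<open>of_nat\<close> is the evident enumeration.
  The space of n-tuples of quaternions, identified with the space of 4n real coordinates, is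
  \<open>'n hspace\<close>; the coordinate with number m is \<open>x $ of_nat m\<close> for m < 4n.
\<close>

type_synonym 'n hspace = "(real, 'n bit0 bit0) vec"

lemma bit0_enumeration:
  "bij_betw of_nat {..<2 * CARD('n)} (UNIV :: 'n::finite bit0 set)"
  "strict_mono_on {..<2 * CARD('n)} (of_nat :: nat \<Rightarrow> 'n bit0)"
proof -
  have Rep: "Rep_bit0 (of_nat m :: 'n bit0) = int m" if "m < 2 * CARD('n)" for m
    using that by (simp add: bit0.of_nat_eq bit0.Abs_inverse)
  show mono: "strict_mono_on {..<2 * CARD('n)} (of_nat :: nat \<Rightarrow> 'n bit0)"
    by (auto simp: strict_mono_on_def less_bit0_def Rep)
  have "card ((of_nat :: nat \<Rightarrow> 'n bit0) ` {..<2 * CARD('n)}) = CARD('n bit0)"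
    using card_image[OF strict_mono_on_imp_inj_on[OF mono]] by simp
  then show "bij_betw of_nat {..<2 * CARD('n)} (UNIV :: 'n bit0 set)"
    using strict_mono_on_imp_inj_on[OF mono]
    by (metis bij_betw_def card_subset_eq finite_class.finite_UNIV subset_UNIV)
qed

text \<open>
  For a finite linearly ordered type \<open>'k\<close>, an element of the exterior algebra of a complex vector
  space with basis \<open>\<omega>\<^sub>k\<close>, \<open>k :: 'k\<close>, is given by its coefficients with respect to the basis of
  ordered products \<open>\<omega>\<^sub>I\<close>. A strictly increasing multi-index is the same as the set of its entries.
  With \<open>'k = 'n bit0\<close> the vector space is 2n-dimensional; vectors are given by their
  coordinates in the fixed basis, whichever basis that is.
\<close>

type_synonym 'k ext = "(complex, 'k set) vec"

text \<open>The sign of the permutation sorting the concatenation of two increasing multi-indices.\<close>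

definition shuffle_sign :: "'k::linorder set \<Rightarrow> 'k set \<Rightarrow> complex" where
  "shuffle_sign I J = (-1) ^ card {(i, j) \<in> I \<times> J. j < i}"

definition wedge :: "'k::{finite,linorder} ext \<Rightarrow> 'k ext \<Rightarrow> 'k ext" (infixr \<open>\<and>\<^sub>w\<close> 75) where
  "a \<and>\<^sub>w b = (\<chi> K. \<Sum>I\<in>Pow K. shuffle_sign I (K - I) * a $ I * b $ (K - I))"

definition ext_one :: "'k::{finite,linorder} ext" where
  "ext_one = axis {} 1"

definition omega :: "'k::{finite,linorder} \<Rightarrow> 'k ext" where
  "omega k = axis {k} 1"

definition omega_multi :: "'k::{finite,linorder} set \<Rightarrow> 'k ext" where
  "omega_multi I = foldr (\<lambda>i a. omega i \<and>\<^sub>w a) (sorted_list_of_set I) ext_one"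

definition ext_power :: "nat \<Rightarrow> 'k::{finite,linorder} ext set" where
  "ext_power p = {a. \<forall>I. card I \<noteq> p \<longrightarrow> a $ I = 0}"

text \<open>
  The following facts confirm that this is the exterior algebra: the product is associative and
  unital (and visibly bilinear), the generators anticommute and square to zero, and the ordered
  products \<open>\<omega>\<^sub>I\<close> form a basis, with respect to which \<open>a $ I\<close> are the coefficients.
\<close>

lemma shuffle_sign_eq_1:
  assumes "\<And>i j. i \<in> I \<Longrightarrow> j \<in> J \<Longrightarrow> \<not> j < i"
  shows "shuffle_sign I J = 1"
proof -
  have "{(i, j) \<in> I \<times> J. j < i} = {}"
    using assms by blast
  then show ?thesis
    by (simp only: shuffle_sign_def card.empty power_0)
qed

lemma shuffle_sign_Un_left:
  fixes I J L :: "'k::{finite,linorder} set"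
  assumes "I \<inter> J = {}"
  shows "shuffle_sign (I \<union> J) L = shuffle_sign I L * shuffle_sign J L"
proof -
  have "{(i, l) \<in> (I \<union> J) \<times> L. l < i} = {(i, l) \<in> I \<times> L. l < i} \<union> {(i, l) \<in> J \<times> L. l < i}"
    by auto
  moreover have "{(i, l) \<in> I \<times> L. l < i} \<inter> {(i, l) \<in> J \<times> L. l < i} = {}"
    using assms by auto
  ultimately show ?thesis
    by (simp add: shuffle_sign_def card_Un_disjoint power_add)
qed

lemma shuffle_sign_Un_right:
  fixes I J L :: "'k::{finite,linorder} set"
  assumes "J \<inter> L = {}"
  shows "shuffle_sign I (J \<union> L) = shuffle_sign I J * shuffle_sign I L"
proof -
  have "{(i, l) \<in> I \<times> (J \<union> L). l < i} = {(i, l) \<in> I \<times> J. l < i} \<union> {(i, l) \<in> I \<times> L. l < i}"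
    by auto
  moreover have "{(i, l) \<in> I \<times> J. l < i} \<inter> {(i, l) \<in> I \<times> L. l < i} = {}"
    using assms by auto
  ultimately show ?thesis
    by (simp add: shuffle_sign_def card_Un_disjoint power_add)
qed

lemma wedge_assoc: "(a \<and>\<^sub>w b) \<and>\<^sub>w c = a \<and>\<^sub>w (b \<and>\<^sub>w c)"
proof (rule vec_eq_iff[THEN iffD2], rule allI)
  fix K :: "'a set"
  let ?l = "\<lambda>M I. shuffle_sign M (K - M) * (shuffle_sign I (M - I) * a $ I * b $ (M - I)) * c $ (K - M)"
  let ?r = "\<lambda>I J. shuffle_sign I (K - I) * a $ I *
    (shuffle_sign J (K - I - J) * b $ J * c $ (K - I - J))"
  have "((a \<and>\<^sub>w b) \<and>\<^sub>w c) $ K = (\<Sum>M\<in>Pow K. \<Sum>I\<in>Pow M. ?l M I)"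
    by (simp add: wedge_def sum_distrib_left sum_distrib_right)
  also have "\<dots> = (\<Sum>(M, I)\<in>Sigma (Pow K) Pow. ?l M I)"
    by (rule sum.Sigma) auto
  also have "\<dots> = (\<Sum>(I, J)\<in>Sigma (Pow K) (\<lambda>I. Pow (K - I)). ?r I J)"
  proof (rule sum.reindex_bij_witness[where i = "\<lambda>(I, J). (I \<union> J, I)" and j = "\<lambda>(M, I). (I, M - I)"],
      goal_cases)
    case (5 x)
    then obtain M I where x: "x = (M, I)" "M \<subseteq> K" "I \<subseteq> M"
      by auto
    have K: "K - I - (M - I) = K - M"
      using x by auto
    have "M = I \<union> (M - I)" "K - I = (M - I) \<union> (K - M)"
      using x by auto
    then have "shuffle_sign M (K - M) = shuffle_sign I (K - M) * shuffle_sign (M - I) (K - M)"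
      and "shuffle_sign I (K - I) = shuffle_sign I (M - I) * shuffle_sign I (K - M)"
      using shuffle_sign_Un_left[of I "M - I" "K - M"] shuffle_sign_Un_right[of "M - I" "K - M" I]
      by auto
    then show ?case
      by (simp add: x K mult_ac)
  qed auto
  also have "\<dots> = (\<Sum>I\<in>Pow K. \<Sum>J\<in>Pow (K - I). ?r I J)"
    by (rule sum.Sigma[symmetric]) auto
  also have "\<dots> = (a \<and>\<^sub>w (b \<and>\<^sub>w c)) $ K"
    by (simp add: wedge_def sum_distrib_left)
  finally show "((a \<and>\<^sub>w b) \<and>\<^sub>w c) $ K = (a \<and>\<^sub>w (b \<and>\<^sub>w c)) $ K" .
qed

lemma wedge_axis:
  "axis I 1 \<and>\<^sub>w axis J 1 = (if I \<inter> J = {} then shuffle_sign I J *s axis (I \<union> J) 1 else 0)"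
proof (rule vec_eq_iff[THEN iffD2], rule allI)
  fix K :: "'a set"
  have "(axis I 1 \<and>\<^sub>w axis J 1) $ K =
      (\<Sum>I'\<in>Pow K. if I' = I then (if J = K - I then shuffle_sign I J else 0) else 0)"
    unfolding wedge_def vec_lambda_beta by (rule sum.cong) (auto simp: axis_def)
  also have "\<dots> = (if I \<subseteq> K \<and> J = K - I then shuffle_sign I J else 0)"
    by (simp add: sum.delta)
  also have "I \<subseteq> K \<and> J = K - I \<longleftrightarrow> I \<inter> J = {} \<and> K = I \<union> J"
    by auto
  finally show "(axis I 1 \<and>\<^sub>w axis J 1) $ K =
      (if I \<inter> J = {} then shuffle_sign I J *s axis (I \<union> J) 1 else 0) $ K"
    by (auto simp: axis_def)
qed

lemma ext_one_wedge: "ext_one \<and>\<^sub>w a = a" and wedge_ext_one: "a \<and>\<^sub>w ext_one = a"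
proof -
  have sign: "shuffle_sign {} J = 1" "shuffle_sign J {} = 1" for J :: "'a set"
    by (auto intro!: shuffle_sign_eq_1)
  have "(ext_one \<and>\<^sub>w a) $ K = (\<Sum>I\<in>Pow K. if I = {} then a $ K else 0)" for K
    unfolding wedge_def vec_lambda_beta
    by (rule sum.cong) (auto simp: ext_one_def axis_def sign)
  then show "ext_one \<and>\<^sub>w a = a"
    by (simp add: vec_eq_iff)
  have "(a \<and>\<^sub>w ext_one) $ K = (\<Sum>I\<in>Pow K. if I = K then a $ K else 0)" for K
    unfolding wedge_def vec_lambda_beta
    by (rule sum.cong) (auto simp: ext_one_def axis_def sign)
  then show "a \<and>\<^sub>w ext_one = a"
    by (simp add: vec_eq_iff)
qed

lemma omega_wedge_self: "omega k \<and>\<^sub>w omega k = 0"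
  by (simp add: omega_def wedge_axis)

lemma omega_wedge_anticommute: "omega j \<and>\<^sub>w omega k = - (omega k \<and>\<^sub>w omega j)"
proof -
  have "{(i, l). i = a \<and> l = b \<and> l < i} = (if b < a then {(a, b)} else {})" for a b :: 'a
    by auto
  then have "shuffle_sign {a} {b} = (if b < a then -1 else 1)" for a b :: 'a
    by (simp add: shuffle_sign_def)
  then show ?thesis
    by (cases j k rule: linorder_cases)
      (auto simp: omega_def wedge_axis insert_commute vec_eq_iff)
qed

lemma omega_multi_eq_axis: "omega_multi I = axis I 1"
proof -
  have "foldr (\<lambda>i a. omega i \<and>\<^sub>w a) xs ext_one = axis (set xs) 1"
    if "sorted_wrt (<) xs" for xs :: "'a list"
    using that
  proof (induction xs)
    case (Cons x xs)
    then have "shuffle_sign {x} (set xs) = 1" "x \<notin> set xs"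
      by (auto intro!: shuffle_sign_eq_1)
    with Cons show ?case
      by (simp add: omega_def wedge_axis)
  qed (simp add: ext_one_def)
  then show ?thesis
    by (simp add: omega_multi_def)
qed

lemma ext_expansion: "a = (\<Sum>I\<in>UNIV. a $ I *s omega_multi I)"
  by (simp add: omega_multi_eq_axis basis_expansion)

fun C_k_on :: "nat \<Rightarrow> ('a::euclidean_space \<Rightarrow> 'b::real_normed_vector) \<Rightarrow> 'a set \<Rightarrow> bool" where
  "C_k_on 0 f S \<longleftrightarrow> continuous_on S f"
| "C_k_on (Suc k) f S \<longleftrightarrow> (\<forall>x\<in>S. f differentiable at x) \<and>
     (\<forall>v. C_k_on k (\<lambda>x. frechet_derivative f (at x) v) S)"

definition smooth :: "('a::euclidean_space \<Rightarrow> 'b::real_normed_vector) \<Rightarrow> bool" where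
  "smooth f \<longleftrightarrow> (\<forall>k. C_k_on k f UNIV)"

text \<open>
  A compactly supported form on \<open>\<Omega>\<close> is represented by its extension by zero to the whole space.
\<close>

definition test_forms :: "'n::finite hspace set \<Rightarrow> nat \<Rightarrow> ('n hspace \<Rightarrow> 'n bit0 ext) set" where
  "test_forms \<Omega> p = {F. smooth F \<and> compact (closure {x. F x \<noteq> 0}) \<and> closure {x. F x \<noteq> 0} \<subseteq> \<Omega> \<and>
     (\<forall>x. F x \<in> ext_power p)}"

definition pd :: "nat \<Rightarrow> ('n::finite hspace \<Rightarrow> complex) \<Rightarrow> 'n hspace \<Rightarrow> complex" where
  "pd m f x = vector_derivative (\<lambda>t. f (x + t *\<^sub>R axis (of_nat m) 1)) (at 0)"

text \<open>
  The row index j is 2l or 2l + 1; the column index \<open>\<alpha>\<close> is only meant to be 0 or 1.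
\<close>

definition nabla :: "nat \<Rightarrow> nat \<Rightarrow> ('n::finite hspace \<Rightarrow> complex) \<Rightarrow> 'n hspace \<Rightarrow> complex" where
  "nabla j \<alpha> f x = (let l = j div 2 in
     if even j then
       (if \<alpha> = 0 then pd (4*l) f x + \<i> * pd (4*l+1) f x
        else - pd (4*l+2) f x - \<i> * pd (4*l+3) f x)
     else
       (if \<alpha> = 0 then pd (4*l+2) f x - \<i> * pd (4*l+3) f x
        else pd (4*l) f x - \<i> * pd (4*l+1) f x))"

definition d_op :: "nat \<Rightarrow> ('n::finite hspace \<Rightarrow> 'n bit0 ext) \<Rightarrow> 'n hspace \<Rightarrow> 'n bit0 ext" where
  "d_op \<alpha> F x = (\<Sum>k<2 * CARD('n). \<Sum>I\<in>UNIV.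
     nabla k \<alpha> (\<lambda>y. F y $ I) x *s (omega (of_nat k) \<and>\<^sub>w omega_multi I))"

end

theory Submission
  imports Defs
begin

text \<open>
  Collecting the coefficients of the partial derivatives, both operators take the form
  \<open>d\<^sub>\<alpha> F = \<Sum>\<^sub>s \<theta>\<^sub>s \<and> \<partial>\<^sub>v\<^sub>(\<^sub>s\<^sub>) F\<close> with constant complex covectors \<open>\<theta>\<^sub>s\<close> and constant real directions
  \<open>v(s)\<close> (lemma \<open>d_op_eq_wedge_op\<close>). Every operator of this form
  shares the algebra of the exterior derivative.

  Composing two of them gives \<open>\<Sum>\<^sub>s\<^sub>,\<^sub>t \<theta>\<^sub>s \<and> \<eta>\<^sub>t \<and> \<partial>\<^sub>v\<^sub>(\<^sub>s\<^sub>) \<partial>\<^sub>w\<^sub>(\<^sub>t\<^sub>) F\<close>. Second derivatives are symmetric and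
  covectors anticommute, so exchanging the two operators changes the sign
  (lemma \<open>wedge_op_anticommute\<close>). With two different operators this is the first claim; with one
  operator \<open>d\<close> it says \<open>d\<^sup>2 = -d\<^sup>2\<close>, which is the second.

  For the third claim, the derivative of the bilinear product is
  \<open>\<theta> \<and> \<partial>(F \<and> G) = \<theta> \<and> \<partial>F \<and> G + \<theta> \<and> F \<and> \<partial>G\<close>, and moving the covector \<open>\<theta>\<close> past the form \<open>F\<close> of
  degree \<open>p\<close> costs the sign \<open>(-1)\<^sup>p\<close> (lemmas \<open>wedge_graded_commute\<close> and \<open>wedge_op_Leibniz\<close>).
\<close>

section \<open>Symmetry of second derivatives\<close>

definition dir_deriv ::
    "'a::real_normed_vector \<Rightarrow> ('a \<Rightarrow> 'b::real_normed_vector) \<Rightarrow> 'a \<Rightarrow> 'b" where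
  "dir_deriv v f x = frechet_derivative f (at x) v"

lemma has_vector_derivative_along_line:
  assumes "f differentiable at (x + t *\<^sub>R v)"
  shows "((\<lambda>t. f (x + t *\<^sub>R v)) has_vector_derivative dir_deriv v f (x + t *\<^sub>R v)) (at t within S)"
proof -
  let ?D = "frechet_derivative f (at (x + t *\<^sub>R v))"
  have f: "(f has_derivative ?D) (at (x + t *\<^sub>R v))"
    using assms by (simp add: frechet_derivative_works)
  have "((\<lambda>t. f (x + t *\<^sub>R v)) has_derivative (\<lambda>h. ?D (h *\<^sub>R v))) (at t within S)"
    by (rule has_derivative_compose[where g = f and g' = ?D and f = "\<lambda>t. x + t *\<^sub>R v", OF _ f])
      (auto intro!: derivative_eq_intros)
  then show ?thesis
    by (simp add: has_vector_derivative_def dir_deriv_def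
        linear_scale[OF linear_frechet_derivative[OF assms]])
qed

lemma C_k_on_2D:
  assumes "C_k_on 2 f UNIV"
  shows "f differentiable at x" "dir_deriv v f differentiable at x"
    "continuous_on UNIV (dir_deriv w (dir_deriv v f))"
  using assms by (simp_all add: numeral_2_eq_2 dir_deriv_def[abs_def])

text \<open>
  The increment \<open>f (x + s u + t v) - f (x + t v)\<close> is the integral of \<open>\<partial>\<^sub>u f\<close> over a segment.
  Differentiating with respect to \<open>t\<close> under the integral sign expresses the increment of \<open>\<partial>\<^sub>v f\<close> in
  the direction \<open>u\<close> as an integral of \<open>\<partial>\<^sub>v \<partial>\<^sub>u f\<close>; its derivative at \<open>s = 0\<close> is the claim.
\<close>

lemma dir_deriv_commute:
  fixes f :: "'a::euclidean_space \<Rightarrow> 'b::banach"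
  assumes f: "C_k_on 2 f UNIV"
  shows "dir_deriv v (dir_deriv u f) x = dir_deriv u (dir_deriv v f) x"
proof -
  let ?g = "\<lambda>\<sigma>. dir_deriv v (dir_deriv u f) (x + \<sigma> *\<^sub>R u)"
  have swap: "x + \<sigma> *\<^sub>R u + t *\<^sub>R v = x + t *\<^sub>R v + \<sigma> *\<^sub>R u" for \<sigma> t
    by (simp add: add_ac)
  have cont_uv: "continuous_on UNIV (dir_deriv v (dir_deriv u f))"
    by (rule C_k_on_2D[OF f])
  have cont_u: "continuous_on UNIV (dir_deriv u f)"
    using C_k_on_2D(2)[OF f]
    by (simp add: continuous_at_imp_continuous_on differentiable_imp_continuous_within)
  have incr_f: "integral {0..s} (\<lambda>\<sigma>. dir_deriv u f (x + \<sigma> *\<^sub>R u + t *\<^sub>R v))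
      = f (x + s *\<^sub>R u + t *\<^sub>R v) - f (x + t *\<^sub>R v)" if "0 \<le> s" for s t :: real
  proof (rule integral_unique)
    have "((\<lambda>\<sigma>. f (x + \<sigma> *\<^sub>R u + t *\<^sub>R v)) has_vector_derivative
        dir_deriv u f (x + \<sigma> *\<^sub>R u + t *\<^sub>R v)) (at \<sigma> within {0..s})" for \<sigma>
      unfolding swap by (rule has_vector_derivative_along_line) (rule C_k_on_2D[OF f])
    then show "((\<lambda>\<sigma>. dir_deriv u f (x + \<sigma> *\<^sub>R u + t *\<^sub>R v)) has_integral
        (f (x + s *\<^sub>R u + t *\<^sub>R v) - f (x + t *\<^sub>R v))) {0..s}"
      using fundamental_theorem_of_calculus[OF that, of "\<lambda>\<sigma>. f (x + \<sigma> *\<^sub>R u + t *\<^sub>R v)"] by auto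
  qed
  have incr_dv: "integral {0..s} ?g = dir_deriv v f (x + s *\<^sub>R u) - dir_deriv v f x"
    if "0 \<le> s" for s :: real
  proof -
    have "((\<lambda>t. integral (cbox 0 s) (\<lambda>\<sigma>. dir_deriv u f (x + \<sigma> *\<^sub>R u + t *\<^sub>R v)))
        has_vector_derivative integral (cbox 0 s)
          (\<lambda>\<sigma>. dir_deriv v (dir_deriv u f) (x + \<sigma> *\<^sub>R u + 0 *\<^sub>R v))) (at 0 within UNIV)"
    proof (rule leibniz_rule_vector_derivative)
      show "((\<lambda>t. dir_deriv u f (x + \<sigma> *\<^sub>R u + t *\<^sub>R v)) has_vector_derivative
          dir_deriv v (dir_deriv u f) (x + \<sigma> *\<^sub>R u + t *\<^sub>R v)) (at t within UNIV)" for t \<sigma> :: real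
        by (rule has_vector_derivative_along_line) (rule C_k_on_2D[OF f])
      show "(\<lambda>\<sigma>. dir_deriv u f (x + \<sigma> *\<^sub>R u + t *\<^sub>R v)) integrable_on cbox 0 s" for t
        by (intro integrable_continuous continuous_on_compose2[OF cont_u] continuous_intros) auto
      show "continuous_on (UNIV \<times> cbox 0 s)
          (\<lambda>(t, \<sigma>). dir_deriv v (dir_deriv u f) (x + \<sigma> *\<^sub>R u + t *\<^sub>R v))"
        unfolding split_beta
        by (intro continuous_on_compose2[OF cont_uv] continuous_intros) auto
    qed auto
    then have "((\<lambda>t. f (x + s *\<^sub>R u + t *\<^sub>R v) - f (x + t *\<^sub>R v))
        has_vector_derivative integral {0..s} ?g) (at 0)"
      by (simp add: incr_f[OF that])
    moreover have "((\<lambda>t. f (x + s *\<^sub>R u + t *\<^sub>R v) - f (x + t *\<^sub>R v)) has_vector_derivative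
        (dir_deriv v f (x + s *\<^sub>R u + 0 *\<^sub>R v) - dir_deriv v f (x + 0 *\<^sub>R v))) (at 0)"
      by (intro has_vector_derivative_diff has_vector_derivative_along_line C_k_on_2D[OF f])
    ultimately show ?thesis
      by (simp add: vector_derivative_unique_at)
  qed
  have "((\<lambda>s. integral {0..s} ?g) has_vector_derivative ?g 0) (at 0 within {0..1})"
    by (rule integral_has_vector_derivative)
      (auto intro!: continuous_on_compose2[OF cont_uv] continuous_intros)
  then have "((\<lambda>s. dir_deriv v f (x + s *\<^sub>R u) - dir_deriv v f x)
      has_vector_derivative ?g 0) (at 0 within {0..1})"
    by (rule has_vector_derivative_transform[rotated 2]) (auto simp: incr_dv)
  moreover have "((\<lambda>s. dir_deriv v f (x + s *\<^sub>R u) - dir_deriv v f x) has_vector_derivative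
      (dir_deriv u (dir_deriv v f) (x + 0 *\<^sub>R u) - 0)) (at 0 within {0..1})"
    by (intro has_vector_derivative_diff has_vector_derivative_along_line has_vector_derivative_const
        C_k_on_2D[OF f])
  moreover have "at (0::real) within {0..1} \<noteq> bot"
    by (simp add: at_within_Icc_at_right)
  ultimately show ?thesis
    by (metis (no_types, lifting) vector_derivative_unique_within add.right_neutral scaleR_zero_left
        diff_zero)
qed

section \<open>Bilinearity and graded commutativity of the exterior product\<close>

lemma wedge_add_left: "(a + b) \<and>\<^sub>w c = a \<and>\<^sub>w c + b \<and>\<^sub>w c"
  and wedge_add_right: "a \<and>\<^sub>w (b + c) = a \<and>\<^sub>w b + a \<and>\<^sub>w c"
  by (simp_all add: wedge_def vec_eq_iff algebra_simps sum.distrib)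

lemma wedge_scale_left: "(c *s a) \<and>\<^sub>w b = c *s (a \<and>\<^sub>w b)"
  and wedge_scale_right: "a \<and>\<^sub>w (c *s b) = c *s (a \<and>\<^sub>w b)"
  by (simp_all add: wedge_def vec_eq_iff sum_distrib_left mult_ac)

lemma bounded_bilinear_wedge:
  "bounded_bilinear (wedge :: 'k::{finite,linorder} ext \<Rightarrow> 'k ext \<Rightarrow> 'k ext)"
proof -
  have scaleR: "r *\<^sub>R a = complex_of_real r *s a" for r and a :: "'k ext"
    by (simp add: vec_eq_iff scaleR_conv_of_real[where 'a = complex])
  have "bilinear (wedge :: 'k ext \<Rightarrow> 'k ext \<Rightarrow> 'k ext)"
    unfolding bilinear_def
    by (auto intro!: linearI
        simp: wedge_add_left wedge_add_right scaleR wedge_scale_left wedge_scale_right)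
  then show ?thesis
    by (simp add: bilinear_conv_bounded_bilinear)
qed

interpretation wedge: bounded_bilinear "wedge :: 'k::{finite,linorder} ext \<Rightarrow> 'k ext \<Rightarrow> 'k ext"
  by (rule bounded_bilinear_wedge)

text \<open>Each pair in \<open>I \<times> J\<close> is an inversion of exactly one of the two concatenations.\<close>

lemma shuffle_sign_swap:
  fixes I J :: "'k::{finite,linorder} set"
  assumes "I \<inter> J = {}"
  shows "shuffle_sign I J = (-1) ^ (card I * card J) * shuffle_sign J I"
proof -
  let ?A = "{(i, j) \<in> I \<times> J. j < i}" and ?B = "{(j, i) \<in> J \<times> I. i < j}"
  have "card I * card J = card (I \<times> J)"
    by simp
  also have "I \<times> J = ?A \<union> prod.swap ` ?B"
    using assms by (force simp: image_iff)
  also have "card (?A \<union> prod.swap ` ?B) = card ?A + card (prod.swap ` ?B)"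
    by (rule card_Un_disjoint) auto
  also have "card (prod.swap ` ?B) = card ?B"
    by (simp add: card_image)
  finally have "(-1 :: complex) ^ (card I * card J) * (-1) ^ card ?B
      = (-1) ^ card ?A * ((-1) ^ card ?B * (-1) ^ card ?B)"
    by (simp add: power_add)
  then show ?thesis
    by (simp add: shuffle_sign_def flip: power_mult_distrib)
qed

text \<open>
  Exchanging the factors matches the splitting \<open>K = I \<union> (K - I)\<close> with the complementary one. For
  homogeneous factors only splittings into \<open>p\<close> and \<open>q\<close> elements contribute, so the sign relating
  the two sorting permutations is the same for all of them.
\<close>

lemma wedge_graded_commute:
  fixes a b :: "'k::{finite,linorder} ext"
  assumes a: "a \<in> ext_power p" and b: "b \<in> ext_power q"
  shows "a \<and>\<^sub>w b = (-1) ^ (p * q) *s (b \<and>\<^sub>w a)"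
proof -
  have "(a \<and>\<^sub>w b) $ K = (-1) ^ (p * q) * (b \<and>\<^sub>w a) $ K" for K
  proof -
    have sign: "shuffle_sign I (K - I) * a $ I * b $ (K - I)
        = (-1) ^ (p * q) * (shuffle_sign (K - I) I * b $ (K - I) * a $ I)" if "I \<subseteq> K" for I
    proof (cases "card I = p \<and> card (K - I) = q")
      case True
      then show ?thesis
        using shuffle_sign_swap[of I "K - I"] by (simp add: Int_Diff mult_ac)
    next
      case False
      then have "a $ I = 0 \<or> b $ (K - I) = 0"
        using a b by (auto simp: ext_power_def)
      then show ?thesis by auto
    qed
    have "(a \<and>\<^sub>w b) $ K
        = (\<Sum>I\<in>Pow K. (-1) ^ (p * q) * (shuffle_sign (K - I) I * b $ (K - I) * a $ I))"
      by (auto simp: wedge_def sign intro!: sum.cong)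
    also have "\<dots> = (\<Sum>I\<in>Pow K. (-1) ^ (p * q) * (shuffle_sign I (K - I) * b $ I * a $ (K - I)))"
      by (rule sum.reindex_bij_witness[where i = "\<lambda>I. K - I" and j = "\<lambda>I. K - I"])
        (auto simp: double_diff)
    also have "\<dots> = (-1) ^ (p * q) * (b \<and>\<^sub>w a) $ K"
      by (simp add: wedge_def sum_distrib_left)
    finally show ?thesis .
  qed
  then show ?thesis
    by (simp add: vec_eq_iff)
qed

lemma covector_anticommute:
  assumes "a \<in> ext_power 1" "b \<in> ext_power 1"
  shows "a \<and>\<^sub>w b = - (b \<and>\<^sub>w a)"
  using wedge_graded_commute[OF assms] by (simp add: vec_eq_iff)

section \<open>First-order operators with covector coefficients\<close>

definition wedge_op ::
    "'s set \<Rightarrow> ('s \<Rightarrow> 'k::{finite,linorder} ext) \<Rightarrow> ('s \<Rightarrow> 'a::real_normed_vector) \<Rightarrow>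
      ('a \<Rightarrow> 'k ext) \<Rightarrow> 'a \<Rightarrow> 'k ext" where
  "wedge_op S \<theta> v F x = (\<Sum>s\<in>S. \<theta> s \<and>\<^sub>w dir_deriv (v s) F x)"

lemma has_derivative_wedge_op:
  fixes F :: "'a::euclidean_space \<Rightarrow> 'k::{finite,linorder} ext"
  assumes "C_k_on 2 F UNIV"
  shows "(wedge_op S \<theta> v F has_derivative
    (\<lambda>h. \<Sum>s\<in>S. \<theta> s \<and>\<^sub>w dir_deriv h (dir_deriv (v s) F) x)) (at x)"
proof -
  have "(dir_deriv u F has_derivative (\<lambda>h. dir_deriv h (dir_deriv u F) x)) (at x)" for u
    using C_k_on_2D(2)[OF assms] unfolding dir_deriv_def[of _ "dir_deriv u F"]
    by (simp add: frechet_derivative_works)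
  then show ?thesis
    unfolding wedge_op_def[abs_def]
    by (intro has_derivative_sum bounded_linear.has_derivative[OF wedge.bounded_linear_right])
qed

lemma wedge_op_wedge_op:
  fixes F :: "'a::euclidean_space \<Rightarrow> 'k::{finite,linorder} ext"
  assumes "C_k_on 2 F UNIV"
  shows "wedge_op S \<theta> v (wedge_op T \<eta> w F) x
    = (\<Sum>s\<in>S. \<Sum>t\<in>T. \<theta> s \<and>\<^sub>w \<eta> t \<and>\<^sub>w dir_deriv (v s) (dir_deriv (w t) F) x)"
proof -
  have "dir_deriv u (wedge_op T \<eta> w F) x = (\<Sum>t\<in>T. \<eta> t \<and>\<^sub>w dir_deriv u (dir_deriv (w t) F) x)" for u
    unfolding dir_deriv_def[of _ "wedge_op T \<eta> w F"]
    by (simp flip: frechet_derivative_at[OF has_derivative_wedge_op[OF assms]])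
  then show ?thesis
    by (simp add: wedge_op_def[of S] wedge.sum_right)
qed

text \<open>
  Covectors anticommute and directional derivatives commute, so the double sums representing the
  two compositions cancel term by term.
\<close>

lemma wedge_op_anticommute:
  fixes F :: "'a::euclidean_space \<Rightarrow> 'k::{finite,linorder} ext"
  assumes F: "C_k_on 2 F UNIV"
    and \<theta>: "\<And>s. s \<in> S \<Longrightarrow> \<theta> s \<in> ext_power 1" and \<eta>: "\<And>t. t \<in> T \<Longrightarrow> \<eta> t \<in> ext_power 1"
  shows "wedge_op S \<theta> v (wedge_op T \<eta> w F) x = - wedge_op T \<eta> w (wedge_op S \<theta> v F) x"
proof -
  have "\<theta> s \<and>\<^sub>w \<eta> t \<and>\<^sub>w dir_deriv (v s) (dir_deriv (w t) F) x
      = - (\<eta> t \<and>\<^sub>w \<theta> s \<and>\<^sub>w dir_deriv (w t) (dir_deriv (v s) F) x)" if "s \<in> S" "t \<in> T" for s t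
    using covector_anticommute[OF \<theta>[OF that(1)] \<eta>[OF that(2)]]
    by (simp add: dir_deriv_commute[OF F, of "v s" "w t"] wedge.minus_left flip: wedge_assoc)
  then show ?thesis
    by (subst (2) wedge_op_wedge_op[OF F], subst sum.swap)
      (simp add: wedge_op_wedge_op[OF F] sum_negf)
qed

text \<open>
  The sign arises in the second term of the product rule, where \<open>\<theta>\<^sub>s\<close> has to be moved past \<open>F\<close>
  to reach the derivative of \<open>G\<close>.
\<close>

lemma wedge_op_Leibniz:
  fixes F G :: "'a::euclidean_space \<Rightarrow> 'k::{finite,linorder} ext"
  assumes F: "F differentiable at x" and G: "G differentiable at x"
    and deg: "F x \<in> ext_power p" and \<theta>: "\<And>s. s \<in> S \<Longrightarrow> \<theta> s \<in> ext_power 1"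
  shows "wedge_op S \<theta> v (\<lambda>x. F x \<and>\<^sub>w G x) x
    = wedge_op S \<theta> v F x \<and>\<^sub>w G x + (-1) ^ p *s (F x \<and>\<^sub>w wedge_op S \<theta> v G x)"
proof -
  have product: "dir_deriv u (\<lambda>x. F x \<and>\<^sub>w G x) x
      = F x \<and>\<^sub>w dir_deriv u G x + dir_deriv u F x \<and>\<^sub>w G x" for u
    using wedge.FDERIV[OF F[unfolded frechet_derivative_works] G[unfolded frechet_derivative_works]]
    by (simp add: dir_deriv_def flip: frechet_derivative_at)
  have summand: "\<theta> s \<and>\<^sub>w dir_deriv u (\<lambda>x. F x \<and>\<^sub>w G x) x
      = (\<theta> s \<and>\<^sub>w dir_deriv u F x) \<and>\<^sub>w G x + (-1) ^ p *s (F x \<and>\<^sub>w \<theta> s \<and>\<^sub>w dir_deriv u G x)"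
    if "s \<in> S" for s u
  proof -
    have "\<theta> s \<and>\<^sub>w F x = (-1) ^ p *s (F x \<and>\<^sub>w \<theta> s)"
      using wedge_graded_commute[OF \<theta>[OF that] deg] by simp
    then have "\<theta> s \<and>\<^sub>w F x \<and>\<^sub>w dir_deriv u G x
        = (-1) ^ p *s (F x \<and>\<^sub>w \<theta> s \<and>\<^sub>w dir_deriv u G x)"
      by (metis wedge_assoc wedge_scale_left)
    then show ?thesis
      by (simp add: product wedge_add_right wedge_assoc)
  qed
  show ?thesis
    by (simp add: wedge_op_def summand sum.distrib wedge.sum_left wedge.sum_right
        vec.scale_sum_right)
qed

section \<open>The operators \<open>d\<^sub>0\<close> and \<open>d\<^sub>1\<close>\<close>

text \<open>
  Each \<open>\<nabla>\<^sub>k\<^sub>\<alpha>\<close> has two terms, numbered by \<open>r = 0, 1\<close>; they are partial derivatives with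
  respect to neighbouring coordinates.
\<close>

definition nabla_coord :: "nat \<Rightarrow> nat \<Rightarrow> nat \<Rightarrow> nat" where
  "nabla_coord \<alpha> k r = 4 * (k div 2) + (if even k = (\<alpha> = 0) then 0 else 2) + r"

definition nabla_coeff :: "nat \<Rightarrow> nat \<Rightarrow> nat \<Rightarrow> complex" where
  "nabla_coeff \<alpha> k r = (if even k then (if \<alpha> = 0 then 1 else -1) * (if r = 0 then 1 else \<i>)
     else if r = 0 then 1 else - \<i>)"

lemma nabla_eq_sum:
  "nabla k \<alpha> f x = (\<Sum>r<2. nabla_coeff \<alpha> k r * pd (nabla_coord \<alpha> k r) f x)"
proof -
  have "{..<2} = {0, 1::nat}"
    by auto
  then show ?thesis
    by (simp add: nabla_def Let_def nabla_coeff_def nabla_coord_def eval_nat_numeral)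
qed

lemma pd_component:
  assumes "F differentiable at x"
  shows "pd m (\<lambda>y. F y $ I) x = dir_deriv (axis (of_nat m) 1) F x $ I"
proof -
  have "((\<lambda>t. F (x + t *\<^sub>R axis (of_nat m) 1) $ I) has_vector_derivative
      dir_deriv (axis (of_nat m) 1) F (x + 0 *\<^sub>R axis (of_nat m) 1) $ I) (at 0)"
    using assms
    by (intro bounded_linear.has_vector_derivative[OF bounded_linear_vec_nth]
        has_vector_derivative_along_line) simp
  then show ?thesis
    by (simp add: pd_def vector_derivative_at)
qed

definition d_covector :: "nat \<Rightarrow> nat \<times> nat \<Rightarrow> 'n::finite bit0 ext" where
  "d_covector \<alpha> = (\<lambda>(k, r). nabla_coeff \<alpha> k r *s omega (of_nat k))"

definition d_direction :: "nat \<Rightarrow> nat \<times> nat \<Rightarrow> 'n::finite hspace" where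
  "d_direction \<alpha> = (\<lambda>(k, r). axis (of_nat (nabla_coord \<alpha> k r)) 1)"

lemma d_covector_degree: "d_covector \<alpha> s \<in> ext_power 1"
  by (auto simp: d_covector_def ext_power_def omega_def axis_def split: prod.splits)

text \<open>
  The components of \<open>F\<close> reassemble by the basis expansion, since each \<open>\<nabla>\<^sub>k\<^sub>\<alpha>\<close> acts on all of them
  alike. Each of the two terms of \<open>\<nabla>\<^sub>k\<^sub>\<alpha>\<close> contributes one covector, namely its complex coefficient
  times \<open>\<omega>\<^sub>k\<close>, and one coordinate direction.
\<close>

lemma d_op_eq_wedge_op:
  fixes F :: "'n::finite hspace \<Rightarrow> 'n bit0 ext"
  assumes F: "F differentiable at x"
  shows "d_op \<alpha> F x
    = wedge_op ({..<2 * CARD('n)} \<times> {..<2}) (d_covector \<alpha>) (d_direction \<alpha>) F x"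
proof -
  have "(\<Sum>I\<in>UNIV. nabla k \<alpha> (\<lambda>y. F y $ I) x *s (omega (of_nat k) \<and>\<^sub>w omega_multi I))
      = (\<Sum>r<2. d_covector \<alpha> (k, r) \<and>\<^sub>w dir_deriv (d_direction \<alpha> (k, r)) F x)" for k
  proof -
    let ?N = "\<Sum>r<2. nabla_coeff \<alpha> k r *s dir_deriv (d_direction \<alpha> (k, r)) F x"
    have "nabla k \<alpha> (\<lambda>y. F y $ I) x = ?N $ I" for I
      by (simp add: nabla_eq_sum pd_component[OF F] d_direction_def)
    then have "(\<Sum>I\<in>UNIV. nabla k \<alpha> (\<lambda>y. F y $ I) x *s (omega (of_nat k) \<and>\<^sub>w omega_multi I))
        = omega (of_nat k) \<and>\<^sub>w (\<Sum>I\<in>UNIV. ?N $ I *s omega_multi I)"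
      by (simp only: wedge.sum_right wedge_scale_right)
    also have "\<dots> = omega (of_nat k) \<and>\<^sub>w ?N"
      by (simp only: flip: ext_expansion)
    finally show ?thesis
      by (simp add: wedge.sum_right wedge_scale_right wedge_scale_left d_covector_def)
  qed
  then show ?thesis
    by (simp add: d_op_def wedge_op_def sum.cartesian_product split_def)
qed

lemma d_op_anticommute:
  fixes F :: "'n::finite hspace \<Rightarrow> 'n bit0 ext"
  assumes F: "C_k_on 2 F UNIV"
  shows "d_op \<alpha> (d_op \<beta> F) x = - d_op \<beta> (d_op \<alpha> F) x"
proof -
  let ?w = "\<lambda>\<alpha>. wedge_op ({..<2 * CARD('n)} \<times> {..<2}) (d_covector \<alpha>) (d_direction \<alpha>)"
  have once: "d_op \<alpha> F = ?w \<alpha> F" for \<alpha>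
    by (rule ext) (rule d_op_eq_wedge_op, rule C_k_on_2D[OF F])
  have "?w \<alpha> F differentiable at x" for \<alpha> x
    using has_derivative_wedge_op[OF F] by (rule differentiableI)
  then have twice: "d_op \<alpha> (d_op \<beta> F) x = ?w \<alpha> (?w \<beta> F) x" for \<alpha> \<beta>
    by (simp add: once d_op_eq_wedge_op)
  show ?thesis
    unfolding twice by (rule wedge_op_anticommute[OF F d_covector_degree d_covector_degree])
qed

theorem proposition2p2:
  fixes \<Omega> :: "'n::finite hspace set"
  assumes "open \<Omega>" and "connected \<Omega>" and "\<Omega> \<noteq> {}"
  shows
    "(\<forall>p. \<forall>F \<in> test_forms \<Omega> p. d_op 0 (d_op 1 F) = (\<lambda>x. - d_op 1 (d_op 0 F) x)) \<and>
     (\<forall>p. \<forall>F \<in> test_forms \<Omega> p. d_op 0 (d_op 0 F) = (\<lambda>x. 0) \<and> d_op 1 (d_op 1 F) = (\<lambda>x. 0)) \<and>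
     (\<forall>p q. \<forall>F \<in> test_forms \<Omega> p. \<forall>G \<in> test_forms \<Omega> q. \<forall>\<alpha> \<in> {0, 1}.
        d_op \<alpha> (\<lambda>x. F x \<and>\<^sub>w G x) =
          (\<lambda>x. d_op \<alpha> F x \<and>\<^sub>w G x + (-1) ^ p *s (F x \<and>\<^sub>w d_op \<alpha> G x)))"
proof -
  have C2: "C_k_on 2 F UNIV" if "F \<in> test_forms \<Omega> p" for F p
    using that by (auto simp: test_forms_def smooth_def)
  have anticommute: "d_op \<alpha> (d_op \<beta> F) = (\<lambda>x. - d_op \<beta> (d_op \<alpha> F) x)"
    if "F \<in> test_forms \<Omega> p" for F p \<alpha> \<beta>
    by (rule ext, rule d_op_anticommute) (rule C2[OF that])
  have square: "d_op \<alpha> (d_op \<alpha> F) = (\<lambda>x. 0)" if F: "F \<in> test_forms \<Omega> p" for F p \<alpha>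
  proof
    fix x
    have "d_op \<alpha> (d_op \<alpha> F) x + d_op \<alpha> (d_op \<alpha> F) x = 0"
      using fun_cong[OF anticommute[OF F, of \<alpha> \<alpha>], of x] by (simp only: eq_neg_iff_add_eq_0)
    then show "d_op \<alpha> (d_op \<alpha> F) x = 0"
      by (simp flip: scaleR_2)
  qed
  have Leibniz: "d_op \<alpha> (\<lambda>x. F x \<and>\<^sub>w G x)
      = (\<lambda>x. d_op \<alpha> F x \<and>\<^sub>w G x + (-1) ^ p *s (F x \<and>\<^sub>w d_op \<alpha> G x))"
    if F: "F \<in> test_forms \<Omega> p" and G: "G \<in> test_forms \<Omega> q" for F G p q \<alpha>
  proof
    fix x
    have diff: "F differentiable at x" "G differentiable at x"
      using C_k_on_2D(1) C2 F G by blast+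
    then have FG: "(\<lambda>x. F x \<and>\<^sub>w G x) differentiable at x"
      using differentiableI[OF wedge.FDERIV] by (simp add: frechet_derivative_works)
    have "F x \<in> ext_power p"
      using F by (simp add: test_forms_def)
    then show "d_op \<alpha> (\<lambda>x. F x \<and>\<^sub>w G x) x
        = d_op \<alpha> F x \<and>\<^sub>w G x + (-1) ^ p *s (F x \<and>\<^sub>w d_op \<alpha> G x)"
      unfolding d_op_eq_wedge_op[OF FG] d_op_eq_wedge_op[OF diff(1)] d_op_eq_wedge_op[OF diff(2)]
      by (rule wedge_op_Leibniz[OF diff _ d_covector_degree])
  qed
  show ?thesis
    by (intro conjI allI ballI; rule anticommute square Leibniz; assumption)
qed

end
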